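(* Let $\lambda$ be an infinite regular cardinal, let $\kappa$ and $\nu$ be infinite cardinals, and let $(\mu_\beta)_{\beta<\kappa}$ be infinite regular cardinals. Then the following three conditions are equivalent. (a) There is a family $(B_{\alpha,\beta})_{\beta<\kappa,\ \alpha<\mu_\beta}$ of subsets of $\lambda$ such that: (i) for every $\beta<\kappa$, $\bigcup_{\alpha<\mu_\beta} B_{\alpha,\beta}=\lambda$; (ii) for every $\beta<\kappa$ and all $\alpha\le\alpha'<\mu_\beta$, $B_{\alpha,\beta}\subseteq B_{\alpha',\beta}$; (iii) for every $f\in\prod_{\beta<\kappa}\mu_\beta$ there exists a subset $F\subseteq\kappa$ with $|F|<\nu$ such that $\left|\bigcap_{\beta\in F} B_{f(\beta),\beta}\right|<\lambda$. (b) Whenever $(X_\beta)_{\beta<\kappa}$ is a family of topological spaces such that for no $\beta<\kappa$ is $X_\beta$ $[\mu_\beta,\mu_\beta]$-compact, the space $X=\Box^{<\nu}_{\beta<\kappa}X_\beta$ is not $[\lambda,\lambda]$-compact. (c) The topological space $\Box^{<\nu}_{\beta<\kappa}\mu_\beta$ is not $[\lambda,\lambda]$-compact, where for each $\beta<\kappa$, $\mu_\beta$ is endowed with the topology whose open sets are exactly the intervals $[0,\alpha)$ for $\alpha\le\mu_\beta$.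
   Context: Cardinals are identified with initial ordinals; the Axiom of Choice is assumed. For infinite cardinals $\kappa,\lambda$, a topological space is called $[\kappa,\lambda]$-compact if every open cover of it consisting of at most $\lambda$ sets has a subcover consisting of fewer than $\kappa$ sets. For a cardinal $\nu$ and a family $(X_\beta)_{\beta<\kappa}$ of topological spaces, the $\Box^{<\nu}$ topology on the product $\prod_{\beta<\kappa}X_\beta$ is the topology having as a base all products $\prod_{\beta<\kappa}Y_\beta$ where each $Y_\beta$ is an open subset of $X_\beta$ and $|\{\beta<\kappa : Y_\beta\neq X_\beta\}|<\nu$; the product with this topology is denoted $\Box^{<\nu}_{\beta<\kappa}X_\beta$. $\prod_{\beta<\kappa}\mu_\beta$ in (a)(iii) denotes the set of functions $f$ with domain $\kappa$ and $f(\beta)<\mu_\beta$ for all $\beta$. No separation axioms are assumed. *)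

theory Defs
  imports "HOL-Analysis.Analysis"
begin

text \<open>
  Cardinals are represented by relations satisfying \<^const>\<open>Card_order\<close>: for such an \<open>r\<close>, the set of
  ordinals below the cardinal is \<open>Field r\<close>, and \<open>(a, b) \<in> r\<close> is \<open>a \<le> b\<close>.
\<close>

unbundle cardinal_syntax

definition bracket_compact :: "'k rel \<Rightarrow> 'l rel \<Rightarrow> 'a topology \<Rightarrow> bool" where
  "bracket_compact \<kappa> lam X \<longleftrightarrow>
     (\<forall>\<U>. (\<forall>U\<in>\<U>. openin X U) \<and> topspace X \<subseteq> \<Union>\<U> \<and> |\<U>| \<le>o lam \<longrightarrow>
        (\<exists>\<V>\<subseteq>\<U>. topspace X \<subseteq> \<Union>\<V> \<and> |\<V>| <o \<kappa>))"

definition box_base :: "'n rel \<Rightarrow> 'i set \<Rightarrow> ('i \<Rightarrow> 'a topology) \<Rightarrow> ('i \<Rightarrow> 'a) set \<Rightarrow> bool" where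
  "box_base \<nu> I X W \<longleftrightarrow>
     (\<exists>Y. W = (\<Pi>\<^sub>E i\<in>I. Y i) \<and> (\<forall>i\<in>I. openin (X i) (Y i)) \<and> |{i\<in>I. Y i \<noteq> topspace (X i)}| <o \<nu>)"

text \<open>
  The function \<^const>\<open>topology\<close> is only meaningful on families satisfying \<^const>\<open>istopology\<close>; this is
  justified for the two topologies below by \<open>openin_box_topology\<close> (infinite \<open>\<nu>\<close>) and
  \<open>openin_initial_segment_topology\<close>.
\<close>

definition box_topology :: "'n rel \<Rightarrow> 'i set \<Rightarrow> ('i \<Rightarrow> 'a topology) \<Rightarrow> ('i \<Rightarrow> 'a) topology" where
  "box_topology \<nu> I X = topology (arbitrary union_of box_base \<nu> I X)"

text \<open>The set \<open>underS r a\<close> is the interval \<open>[0, a)\<close>, and \<open>Field r\<close> is the interval \<open>[0, r)\<close>.\<close>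

definition initial_segment_topology :: "'m rel \<Rightarrow> 'm topology" where
  "initial_segment_topology r = topology (\<lambda>U. (\<exists>a\<in>Field r. U = underS r a) \<or> U = Field r)"

lemma box_base_Int:
  assumes \<nu>: "Cinfinite \<nu>" and "box_base \<nu> I X V" "box_base \<nu> I X W"
  shows "box_base \<nu> I X (V \<inter> W)"
proof -
  obtain Y where Y: "V = (\<Pi>\<^sub>E i\<in>I. Y i)" "\<forall>i\<in>I. openin (X i) (Y i)"
      "|{i\<in>I. Y i \<noteq> topspace (X i)}| <o \<nu>"
    using assms(2) by (auto simp: box_base_def)
  obtain Z where Z: "W = (\<Pi>\<^sub>E i\<in>I. Z i)" "\<forall>i\<in>I. openin (X i) (Z i)"
      "|{i\<in>I. Z i \<noteq> topspace (X i)}| <o \<nu>"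
    using assms(3) by (auto simp: box_base_def)
  have "|{i\<in>I. Y i \<noteq> topspace (X i)} \<union> {i\<in>I. Z i \<noteq> topspace (X i)}| <o \<nu>"
    using \<nu> Y(3) Z(3) by (intro card_of_Un_ordLess_infinite_Field) (auto simp: cinfinite_def)
  moreover have "|{i\<in>I. Y i \<inter> Z i \<noteq> topspace (X i)}|
      \<le>o |{i\<in>I. Y i \<noteq> topspace (X i)} \<union> {i\<in>I. Z i \<noteq> topspace (X i)}|"
    by (rule card_of_mono1) auto
  ultimately have "|{i\<in>I. Y i \<inter> Z i \<noteq> topspace (X i)}| <o \<nu>"
    using ordLeq_ordLess_trans by blast
  moreover have "V \<inter> W = (\<Pi>\<^sub>E i\<in>I. Y i \<inter> Z i)"
    using Y(1) Z(1) by (simp add: PiE_Int)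
  ultimately show ?thesis
    using Y(2) Z(2) unfolding box_base_def by (intro exI[of _ "\<lambda>i. Y i \<inter> Z i"]) auto
qed

lemma openin_box_topology:
  assumes "Cinfinite \<nu>"
  shows "openin (box_topology \<nu> I X) W \<longleftrightarrow> (arbitrary union_of box_base \<nu> I X) W"
proof -
  have "istopology (arbitrary union_of box_base \<nu> I X)"
    by (rule istopology_base) (rule box_base_Int[OF assms])
  then show ?thesis
    unfolding box_topology_def by (simp only: topology_inverse')
qed

lemma openin_initial_segment_topology:
  assumes "Well_order r"
  shows "openin (initial_segment_topology r) U \<longleftrightarrow> (\<exists>a\<in>Field r. U = underS r a) \<or> U = Field r"
proof -
  interpret wo_rel r using assms by (simp add: wo_rel_def)
  have "istopology (Order_Relation.ofilter r)"
    unfolding istopology_def Order_Relation.ofilter_def by fast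
  moreover have "Order_Relation.ofilter r = (\<lambda>U. (\<exists>a\<in>Field r. U = Order_Relation.underS r a) \<or> U = Field r)"
    by (rule ext) (rule ofilter_underS_Field)
  ultimately show ?thesis
    unfolding initial_segment_topology_def by (simp only: topology_inverse')
qed

end

theory Submission
  imports Defs
begin

text \<open>
  For regular \<open>r\<close>, a space fails to be \<open>[r, r]\<close>-compact iff it is the union of an increasing chain,
  indexed by \<open>r\<close>, of proper open subsets.
  Given the sets \<open>B\<close> of (a) and such chains \<open>C \<beta>\<close> in the factors, the open set of index \<open>\<delta> < lam\<close> in
  the product is the union of the boxes with sides \<open>C \<beta> (f \<beta>)\<close>, \<open>\<beta> \<in> F\<close>, for which the intersection
  of the sets \<open>B (f \<beta>) \<beta>\<close> lies below \<open>\<delta>\<close>.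
  Conversely, given a chain \<open>C\<close> in the product of initial segment topologies, choose \<open>x \<xi> \<notin> C \<xi>\<close> and
  let \<open>B \<alpha> \<beta>\<close> consist of all \<open>\<xi>\<close> with \<open>x \<xi> \<beta> \<le> \<alpha>\<close>.
\<close>

section \<open>Open chains as witnesses of non-compactness\<close>

definition open_chain :: "'r rel \<Rightarrow> 'a topology \<Rightarrow> ('r \<Rightarrow> 'a set) \<Rightarrow> bool" where
  "open_chain r X C \<longleftrightarrow>
     (\<forall>a\<in>Field r. openin X (C a) \<and> C a \<noteq> topspace X) \<and>
     (\<forall>a b. (a, b) \<in> r \<longrightarrow> C a \<subseteq> C b) \<and> (\<Union>a\<in>Field r. C a) = topspace X"

lemma open_chainD:
  assumes "open_chain r X C"
  shows "a \<in> Field r \<Longrightarrow> openin X (C a)"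
    and "a \<in> Field r \<Longrightarrow> \<exists>x\<in>topspace X. x \<notin> C a"
    and "(a, b) \<in> r \<Longrightarrow> C a \<subseteq> C b"
    and "x \<in> topspace X \<Longrightarrow> \<exists>a\<in>Field r. x \<in> C a"
proof -
  show op: "openin X (C a)" if "a \<in> Field r"
    using assms that by (simp add: open_chain_def)
  show "\<exists>x\<in>topspace X. x \<notin> C a" if "a \<in> Field r"
  proof -
    have "C a \<noteq> topspace X" "C a \<subseteq> topspace X"
      using assms that openin_subset[OF op] by (simp_all add: open_chain_def)
    then show ?thesis by blast
  qed
  show "C a \<subseteq> C b" if "(a, b) \<in> r"
    using assms that by (simp add: open_chain_def)
  show "\<exists>a\<in>Field r. x \<in> C a" if "x \<in> topspace X"
    using assms that unfolding open_chain_def by blast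
qed

lemma underS_subset_Field: "underS r a \<subseteq> Field r"
  by (auto simp: underS_def intro: FieldI1)

text \<open>By regularity a cofinal subset has the full cardinality, so the smaller \<open>K\<close>
  is not cofinal. Since \<open>cofinal\<close> asks for strictly larger elements, its failure at
  some \<open>a\<close> becomes a non-strict upper bound by totality.\<close>

lemma regularCard_bounded:
  assumes r: "Cinfinite r" "regularCard r" and K: "K \<subseteq> Field r" "|K| <o r"
  obtains a where "a \<in> Field r" "\<And>b. b \<in> K \<Longrightarrow> (b, a) \<in> r"
proof -
  have "\<not> cofinal K r"
    using r(2) K not_ordLess_ordIso unfolding regularCard_def by blast
  then obtain a where a: "a \<in> Field r" "\<forall>b\<in>K. a = b \<or> (a, b) \<notin> r"
    unfolding cofinal_def by blast
  interpret r: wo_rel r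
    using r(1) by (simp add: card_order_on_well_order_on wo_rel_def)
  have "(b, a) \<in> r" if "b \<in> K" for b
    using a that K(1) r.TOTALS by (metis in_mono)
  with a(1) that show thesis by blast
qed

text \<open>A cover witnessing non-compactness is enumerated along \<open>r\<close>, and the chain
  consists of the unions of its initial parts. Each initial part has fewer than \<open>r\<close>
  members, hence cannot cover.\<close>

lemma not_bracket_compact_imp_open_chain:
  assumes r: "Cinfinite r" and X: "\<not> bracket_compact r r X"
  obtains C where "open_chain r X C"
proof -
  obtain \<U> where \<U>: "\<forall>U\<in>\<U>. openin X U" "topspace X \<subseteq> \<Union>\<U>" "|\<U>| \<le>o r"
    and "\<not> (\<exists>\<V>\<subseteq>\<U>. topspace X \<subseteq> \<Union>\<V> \<and> |\<V>| <o r)"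
    using X unfolding bracket_compact_def not_all not_imp by (elim exE conjE)
  then have no: "\<not> topspace X \<subseteq> \<Union>\<V>" if "\<V> \<subseteq> \<U>" "|\<V>| <o r" for \<V>
    using that by blast
  interpret r: wo_rel r
    using r by (simp add: card_order_on_well_order_on wo_rel_def)
  have co: "Card_order r" using r by simp
  obtain z where z: "z \<in> Field r"
    using r unfolding cinfinite_def by fastforce
  have small: "|underS r a| <o r" if "a \<in> Field r" for a
    using card_of_underS[OF co that] .
  have "|{}::'b set set| <o r"
    using ordLeq_ordLess_trans[OF card_of_empty small[OF z]] .
  \<comment> \<open>An enumeration of \<open>\<U>\<close> by \<open>Field r\<close> exists only for
    nonempty \<open>\<U>\<close>. The empty subfamily is smaller than \<open>r\<close>, so it does
    not cover, whereas \<open>\<U>\<close> does.\<close>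
  then have "\<U> \<noteq> {}"
    using no[of "{}"] \<U>(2) by auto
  moreover have "|\<U>| \<le>o |Field r|"
    using \<U>(3) card_of_Field_ordIso[OF co] ordIso_symmetric ordLeq_ordIso_trans by blast
  ultimately obtain u where u: "u ` Field r = \<U>"
    using card_of_ordLeq2 by metis
  define C where "C a = \<Union> (u ` underS r a)" for a
  have sub: "u ` underS r a \<subseteq> \<U>" for a
    using image_mono[OF underS_subset_Field, of u r a] unfolding u .
  have "open_chain r X C"
    unfolding open_chain_def
  proof (intro conjI ballI allI impI)
    fix a assume a: "a \<in> Field r"
    show "openin X (C a)"
      unfolding C_def by (rule openin_Union) (use sub \<U>(1) in blast)
    have "|u ` underS r a| <o r"
      using ordLeq_ordLess_trans[OF card_of_image small[OF a]] .
    then show "C a \<noteq> topspace X"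
      unfolding C_def using no[OF sub] by auto
  next
    fix a b assume "(a, b) \<in> r"
    then have "underS r a \<subseteq> underS r b"
      by (rule underS_incr[OF r.TRANS r.ANTISYM])
    then show "C a \<subseteq> C b"
      unfolding C_def by blast
  next
    show "(\<Union>a\<in>Field r. C a) = topspace X"
    proof
      show "(\<Union>a\<in>Field r. C a) \<subseteq> topspace X"
        unfolding C_def using sub \<U>(1) openin_subset by blast
      show "topspace X \<subseteq> (\<Union>a\<in>Field r. C a)"
      proof
        fix x assume "x \<in> topspace X"
        then obtain a where a: "a \<in> Field r" "x \<in> u a"
          using \<U>(2) u by blast
        \<comment> \<open>\<open>C a\<close> collects only the sets enumerated strictly before
          \<open>a\<close>, so \<open>u a\<close> first appears at a later stage; one exists because
          an infinite cardinal is a limit.\<close>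
        obtain b where "b \<in> Field r" "a \<noteq> b" "(a, b) \<in> r"
          using Cinfinite_limit[OF a(1) r] by blast
        then show "x \<in> (\<Union>a\<in>Field r. C a)"
          using a unfolding C_def underS_def by blast
      qed
    qed
  qed
  then show thesis by (rule that)
qed

text \<open>The chain is itself a cover by at most \<open>r\<close> sets. The indices of a subcover
  of size below \<open>r\<close> are bounded by regularity, so a single proper member of the chain
  would have to be the whole space.\<close>

lemma open_chain_imp_not_bracket_compact:
  assumes r: "Cinfinite r" "regularCard r" and C: "open_chain r X C"
  shows "\<not> bracket_compact r r X"
proof
  assume X: "bracket_compact r r X"
  have "|C ` Field r| \<le>o r"
    using r(1) card_of_image card_of_Field_ordIso ordLeq_ordIso_trans by blast
  moreover have "\<forall>U\<in>C ` Field r. openin X U" "topspace X \<subseteq> \<Union> (C ` Field r)"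
    using C by (auto simp: open_chain_def)
  ultimately have "\<exists>\<V>\<subseteq>C ` Field r. topspace X \<subseteq> \<Union>\<V> \<and> |\<V>| <o r"
    using X[unfolded bracket_compact_def, rule_format, of "C ` Field r"] by simp
  then obtain \<V> where \<V>: "\<V> \<subseteq> C ` Field r" "topspace X \<subseteq> \<Union>\<V>" "|\<V>| <o r"
    by (elim exE conjE)
  \<comment> \<open>One index is chosen per member, since the chain may repeat sets and the index
    set has to be as small as \<open>\<V>\<close>.\<close>
  obtain K where K: "K \<subseteq> Field r" "inj_on C K" "\<V> = C ` K"
    using \<V>(1) unfolding subset_image_inj by (elim exE conjE)
  have "|K| =o |\<V>|"
    using K by (metis card_of_ordIsoI inj_on_imp_bij_betw)
  then have "|K| <o r"
    using \<V>(3) ordIso_ordLess_trans by blast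
  then obtain a where a: "a \<in> Field r" "\<And>b. b \<in> K \<Longrightarrow> (b, a) \<in> r"
    using regularCard_bounded[OF r K(1)] by blast
  have "topspace X \<subseteq> C a"
    using \<V>(2) K(3) a(2) open_chainD(3)[OF C] by blast
  then show False
    using open_chainD(2)[OF C a(1)] by blast
qed

section \<open>Basic facts on the box topology\<close>

lemma box_base_imp_openin:
  "Cinfinite \<nu> \<Longrightarrow> box_base \<nu> I X W \<Longrightarrow> openin (box_topology \<nu> I X) W"
  by (simp add: openin_box_topology arbitrary_union_of_inc)

lemma openin_box_topology_box:
  assumes "Cinfinite \<nu>" "openin (box_topology \<nu> I X) W" "x \<in> W"
  obtains V where "box_base \<nu> I X V" "x \<in> V" "V \<subseteq> W"
proof -
  have "(arbitrary union_of box_base \<nu> I X) W"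
    using assms(1,2) by (simp add: openin_box_topology)
  then obtain \<V> where "\<V> \<subseteq> Collect (box_base \<nu> I X)" "\<Union>\<V> = W"
    unfolding union_of_def by (elim exE conjE)
  with assms(3) that show thesis by blast
qed

lemma topspace_box_topology:
  assumes "Cinfinite \<nu>"
  shows "topspace (box_topology \<nu> I X) = (\<Pi>\<^sub>E i\<in>I. topspace (X i))"
proof
  obtain z where z: "z \<in> Field \<nu>"
    using assms unfolding cinfinite_def by fastforce
  have "|{}::'b set| <o \<nu>"
    using ordLeq_ordLess_trans[OF card_of_empty card_of_underS[OF _ z]] assms by blast
  then have "box_base \<nu> I X (\<Pi>\<^sub>E i\<in>I. topspace (X i))"
    unfolding box_base_def by (intro exI[of _ "\<lambda>i. topspace (X i)"]) simp
  then show "(\<Pi>\<^sub>E i\<in>I. topspace (X i)) \<subseteq> topspace (box_topology \<nu> I X)"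
    using box_base_imp_openin[OF assms] openin_subset by blast
  show "topspace (box_topology \<nu> I X) \<subseteq> (\<Pi>\<^sub>E i\<in>I. topspace (X i))"
  proof
    fix x assume "x \<in> topspace (box_topology \<nu> I X)"
    then obtain V where V: "box_base \<nu> I X V" "x \<in> V"
      using openin_box_topology_box[OF assms openin_topspace] by metis
    then obtain Y where "V = (\<Pi>\<^sub>E i\<in>I. Y i)" "\<forall>i\<in>I. openin (X i) (Y i)"
      unfolding box_base_def by blast
    moreover from this have "(\<Pi>\<^sub>E i\<in>I. Y i) \<subseteq> (\<Pi>\<^sub>E i\<in>I. topspace (X i))"
      by (intro PiE_mono openin_subset) simp
    ultimately show "x \<in> (\<Pi>\<^sub>E i\<in>I. topspace (X i))"
      using V(2) by blast
  qed
qed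

section \<open>From the sets \<open>B\<close> to non-compactness of the product\<close>

text \<open>This is condition (a) as a predicate on \<open>B\<close>. Intersecting with
  \<open>Field lam\<close> makes the empty \<open>F\<close> yield all of \<open>Field lam\<close>
  rather than the whole type.\<close>

definition covering_matrix ::
  "'l rel \<Rightarrow> 'n rel \<Rightarrow> 'i set \<Rightarrow> ('i \<Rightarrow> 'm rel) \<Rightarrow> ('m \<Rightarrow> 'i \<Rightarrow> 'l set) \<Rightarrow> bool" where
  "covering_matrix lam \<nu> I \<mu> B \<longleftrightarrow>
     (\<forall>\<beta>\<in>I. \<forall>\<alpha>\<in>Field (\<mu> \<beta>). B \<alpha> \<beta> \<subseteq> Field lam) \<and>
     (\<forall>\<beta>\<in>I. (\<Union>\<alpha>\<in>Field (\<mu> \<beta>). B \<alpha> \<beta>) = Field lam) \<and>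
     (\<forall>\<beta>\<in>I. \<forall>\<alpha> \<alpha>'. (\<alpha>, \<alpha>') \<in> \<mu> \<beta> \<longrightarrow> B \<alpha> \<beta> \<subseteq> B \<alpha>' \<beta>) \<and>
     (\<forall>f \<in> (\<Pi>\<^sub>E \<beta>\<in>I. Field (\<mu> \<beta>)).
        \<exists>F\<subseteq>I. |F| <o \<nu> \<and> |Field lam \<inter> (\<Inter>\<beta>\<in>F. B (f \<beta>) \<beta>)| <o lam)"

text \<open>The sets \<open>W\<close> form an open chain in the product: (iii) and the regularity of
  \<open>lam\<close> make them a cover, (i) and (ii) keep each of them proper. The point type of the
  factors is arbitrary, so the lemma yields both (b) and (c).\<close>

lemma covering_matrix_imp_box_not_bracket_compact:
  assumes lam: "Cinfinite lam" "regularCard lam" and \<nu>: "Cinfinite \<nu>"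
    and \<mu>: "\<And>\<beta>. \<beta> \<in> I \<Longrightarrow> Cinfinite (\<mu> \<beta>)"
    and B: "covering_matrix lam \<nu> I \<mu> B"
    and X: "\<And>\<beta>. \<beta> \<in> I \<Longrightarrow> \<not> bracket_compact (\<mu> \<beta>) (\<mu> \<beta>) (X \<beta>)"
  shows "\<not> bracket_compact lam lam (box_topology \<nu> I X)"
proof -
  have "\<exists>C. open_chain (\<mu> \<beta>) (X \<beta>) C" if "\<beta> \<in> I" for \<beta>
    using not_bracket_compact_imp_open_chain[OF \<mu> X] that by blast
  then obtain C where C: "\<And>\<beta>. \<beta> \<in> I \<Longrightarrow> open_chain (\<mu> \<beta>) (X \<beta>) (C \<beta>)"
    by metis
  interpret lam: wo_rel lam
    using lam(1) by (simp add: card_order_on_well_order_on wo_rel_def)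
  define Box where "Box f F = (\<Pi>\<^sub>E \<beta>\<in>I. if \<beta> \<in> F then C \<beta> (f \<beta>) else topspace (X \<beta>))" for f F
  \<comment> \<open>Smallness of the intersection is replaced by the bound \<open>\<delta>\<close>,
    which makes \<open>W\<close> increasing in \<open>\<delta>\<close>.\<close>
  define good where "good \<delta> f F \<longleftrightarrow> f \<in> (\<Pi>\<^sub>E \<beta>\<in>I. Field (\<mu> \<beta>)) \<and> F \<subseteq> I \<and> |F| <o \<nu> \<and>
      Field lam \<inter> (\<Inter>\<beta>\<in>F. B (f \<beta>) \<beta>) \<subseteq> under lam \<delta>" for \<delta> f F
  define W where "W \<delta> = \<Union> {Box f F | f F. good \<delta> f F}" for \<delta>
  have box_open: "openin (box_topology \<nu> I X) (Box f F)" if "good \<delta> f F" for \<delta> f F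
  proof (rule box_base_imp_openin[OF \<nu>])
    define Y where "Y \<beta> = (if \<beta> \<in> F then C \<beta> (f \<beta>) else topspace (X \<beta>))" for \<beta>
    have "|{\<beta> \<in> I. Y \<beta> \<noteq> topspace (X \<beta>)}| \<le>o |F|"
      by (rule card_of_mono1) (auto simp: Y_def)
    then have "|{\<beta> \<in> I. Y \<beta> \<noteq> topspace (X \<beta>)}| <o \<nu>"
      using that ordLeq_ordLess_trans unfolding good_def by blast
    moreover have "\<forall>\<beta>\<in>I. openin (X \<beta>) (Y \<beta>)"
      using that C unfolding Y_def good_def open_chain_def by (auto simp: PiE_iff)
    ultimately show "box_base \<nu> I X (Box f F)"
      unfolding box_base_def Box_def Y_def[symmetric] by (intro exI[of _ Y]) simp
  qed
  have top: "topspace (box_topology \<nu> I X) = (\<Pi>\<^sub>E \<beta>\<in>I. topspace (X \<beta>))"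
    by (rule topspace_box_topology[OF \<nu>])
  have B_cover: "(\<Union>\<alpha>\<in>Field (\<mu> \<beta>). B \<alpha> \<beta>) = Field lam"
    and B_mono: "\<And>\<alpha> \<alpha>'. (\<alpha>, \<alpha>') \<in> \<mu> \<beta> \<Longrightarrow> B \<alpha> \<beta> \<subseteq> B \<alpha>' \<beta>" if "\<beta> \<in> I" for \<beta>
    using B that unfolding covering_matrix_def by simp_all
  have W_open: "openin (box_topology \<nu> I X) (W \<delta>)" for \<delta>
    unfolding W_def using box_open by (intro openin_Union) blast
  have W_mono: "W \<delta> \<subseteq> W \<delta>'" if "(\<delta>, \<delta>') \<in> lam" for \<delta> \<delta>'
  proof -
    have "under lam \<delta> \<subseteq> under lam \<delta>'"
      by (rule under_incr[OF lam.TRANS that])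
    then have "good \<delta>' f F" if "good \<delta> f F" for f F
      using that unfolding good_def by (meson subset_trans)
    then show ?thesis unfolding W_def by blast
  qed
  have W_cover: "\<exists>\<delta>\<in>Field lam. x \<in> W \<delta>" if x: "x \<in> (\<Pi>\<^sub>E \<beta>\<in>I. topspace (X \<beta>))" for x
  proof -
    \<comment> \<open>The function fed to (iii) records, for each coordinate of \<open>x\<close>, a
      stage of the chain \<open>C \<beta>\<close> containing it; it is restricted to
      \<open>I\<close> because (iii) speaks of extensional functions.\<close>
    have "\<exists>\<alpha>\<in>Field (\<mu> \<beta>). x \<beta> \<in> C \<beta> \<alpha>" if "\<beta> \<in> I" for \<beta>
      using x that by (intro open_chainD(4)[OF C[OF that]]) (auto simp: PiE_iff)
    then obtain g where g: "\<And>\<beta>. \<beta> \<in> I \<Longrightarrow> g \<beta> \<in> Field (\<mu> \<beta>) \<and> x \<beta> \<in> C \<beta> (g \<beta>)"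
      by metis
    define f where "f = restrict g I"
    have f: "f \<in> (\<Pi>\<^sub>E \<beta>\<in>I. Field (\<mu> \<beta>))"
      using g by (auto simp: f_def)
    then obtain F where F: "F \<subseteq> I" "|F| <o \<nu>" "|Field lam \<inter> (\<Inter>\<beta>\<in>F. B (f \<beta>) \<beta>)| <o lam"
      using B unfolding covering_matrix_def by blast
    obtain \<delta> where \<delta>: "\<delta> \<in> Field lam" "\<And>\<xi>. \<xi> \<in> Field lam \<inter> (\<Inter>\<beta>\<in>F. B (f \<beta>) \<beta>) \<Longrightarrow> (\<xi>, \<delta>) \<in> lam"
      using regularCard_bounded[OF lam Int_lower1 F(3)] by blast
    have "good \<delta> f F"
      using f F(1,2) \<delta>(2) unfolding good_def under_def by blast
    moreover have "x \<in> Box f F"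
      using x g F(1) unfolding Box_def f_def by (auto simp: PiE_iff)
    ultimately show ?thesis
      using \<delta>(1) unfolding W_def by blast
  qed
  have W_proper: "W \<delta> \<noteq> (\<Pi>\<^sub>E \<beta>\<in>I. topspace (X \<beta>))" if \<delta>: "\<delta> \<in> Field lam" for \<delta>
  proof -
    \<comment> \<open>A point outside \<open>W \<delta>\<close> is built from some \<xi> strictly
      above \<delta>: \<open>g \<beta>\<close> is an index at which \<xi> has entered column
      \<beta>, and \<open>y \<beta>\<close> avoids the stage
      \<open>C \<beta> (g \<beta>)\<close>.\<close>
    obtain \<xi> where \<xi>: "\<xi> \<in> Field lam" "\<delta> \<noteq> \<xi>" "(\<delta>, \<xi>) \<in> lam"
      using Cinfinite_limit[OF \<delta> lam(1)] by (elim bexE conjE)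
    have "\<exists>\<alpha>\<in>Field (\<mu> \<beta>). \<xi> \<in> B \<alpha> \<beta>" if "\<beta> \<in> I" for \<beta>
      using B_cover[OF that] \<xi>(1) by blast
    then obtain g where g: "\<And>\<beta>. \<beta> \<in> I \<Longrightarrow> g \<beta> \<in> Field (\<mu> \<beta>) \<and> \<xi> \<in> B (g \<beta>) \<beta>"
      by metis
    have "\<exists>y \<in> topspace (X \<beta>). y \<notin> C \<beta> (g \<beta>)" if "\<beta> \<in> I" for \<beta>
      using open_chainD(2)[OF C[OF that]] g[OF that] by blast
    then obtain y where y: "\<And>\<beta>. \<beta> \<in> I \<Longrightarrow> y \<beta> \<in> topspace (X \<beta>) \<and> y \<beta> \<notin> C \<beta> (g \<beta>)"
      by metis
    have "restrict y I \<notin> Box f F" if "good \<delta> f F" for f F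
    proof
      assume mem: "restrict y I \<in> Box f F"
      \<comment> \<open>As \<open>y \<beta>\<close> lies in \<open>C \<beta> (f \<beta>)\<close> but
        not in \<open>C \<beta> (g \<beta>)\<close>, the index \<open>f \<beta>\<close> is above
        \<open>g \<beta>\<close>, so \<xi> passes from \<open>B (g \<beta>) \<beta>\<close> to
        \<open>B (f \<beta>) \<beta>\<close>. Holding for all \<beta> in \<open>F\<close>, this
        forces \<xi> below the bound \<delta>.\<close>
      have "\<xi> \<in> B (f \<beta>) \<beta>" if \<beta>: "\<beta> \<in> F" for \<beta>
      proof -
        have \<beta>I: "\<beta> \<in> I" and f\<beta>: "f \<beta> \<in> Field (\<mu> \<beta>)"
          using \<beta> \<open>good \<delta> f F\<close> unfolding good_def by auto
        have "y \<beta> \<in> C \<beta> (f \<beta>)"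
          using mem \<beta> \<beta>I unfolding Box_def by (auto simp: PiE_iff split: if_splits)
        then have "\<not> C \<beta> (f \<beta>) \<subseteq> C \<beta> (g \<beta>)"
          using y[OF \<beta>I] by blast
        then have "(f \<beta>, g \<beta>) \<notin> \<mu> \<beta>"
          using open_chainD(3)[OF C[OF \<beta>I]] by blast
        moreover interpret \<mu>\<beta>: wo_rel "\<mu> \<beta>"
          using \<mu>[OF \<beta>I] by (simp add: card_order_on_well_order_on wo_rel_def)
        have "(f \<beta>, g \<beta>) \<in> \<mu> \<beta> \<or> (g \<beta>, f \<beta>) \<in> \<mu> \<beta>"
          using \<mu>\<beta>.TOTALS f\<beta> g[OF \<beta>I] by blast
        ultimately show ?thesis
          using B_mono[OF \<beta>I] g[OF \<beta>I] by blast
      qed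
      then have "(\<xi>, \<delta>) \<in> lam"
        using that \<xi>(1) unfolding good_def under_def by blast
      then show False
        using \<xi> lam.ANTISYM unfolding antisym_def by blast
    qed
    then have "restrict y I \<notin> W \<delta>"
      unfolding W_def by blast
    moreover have "restrict y I \<in> (\<Pi>\<^sub>E \<beta>\<in>I. topspace (X \<beta>))"
      using y by auto
    ultimately show ?thesis by blast
  qed
  have "(\<Union>\<delta>\<in>Field lam. W \<delta>) = topspace (box_topology \<nu> I X)"
    using W_cover W_open openin_subset unfolding top[symmetric] by blast
  then have "open_chain lam (box_topology \<nu> I X) W"
    unfolding open_chain_def using W_open W_mono W_proper top by auto
  then show ?thesis
    by (rule open_chain_imp_not_bracket_compact[OF lam])
qed

section \<open>Initial segment topologies and their pullbacks\<close>

lemma topspace_initial_segment_topology: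
  assumes "Well_order r"
  shows "topspace (initial_segment_topology r) = Field r"
proof
  have "(\<exists>a\<in>Field r. topspace (initial_segment_topology r) = underS r a) \<or>
      topspace (initial_segment_topology r) = Field r"
    using openin_topspace[of "initial_segment_topology r"]
    unfolding openin_initial_segment_topology[OF assms] .
  then show "topspace (initial_segment_topology r) \<subseteq> Field r"
    by (metis order_refl underS_subset_Field)
  show "Field r \<subseteq> topspace (initial_segment_topology r)"
    by (rule openin_subset) (simp add: openin_initial_segment_topology[OF assms])
qed

lemma openin_initial_segment_topology_downward:
  assumes r: "Well_order r" and U: "openin (initial_segment_topology r) U"
    and "b \<in> U" "(a, b) \<in> r"
  shows "a \<in> U"
proof -
  interpret r: wo_rel r using r by (simp add: wo_rel_def)
  have "Order_Relation.ofilter r U"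
    using U unfolding openin_initial_segment_topology[OF r] r.ofilter_underS_Field .
  then show ?thesis
    using assms(3,4) unfolding Order_Relation.ofilter_def under_def by blast
qed

text \<open>Pulling back along a surjection moves the initial segment topology to points of another
  type, as (b) requires for its fixed type of points. The preimages of the intervals below
  \<open>a\<close> still form an open chain.\<close>

lemma pullback_initial_segment_not_bracket_compact:
  assumes r: "Cinfinite r" "regularCard r" and g: "g ` A = Field r"
  shows "\<not> bracket_compact r r (pullback_topology A g (initial_segment_topology r))"
proof -
  have wo: "Well_order r"
    using r(1) by (simp add: card_order_on_well_order_on)
  then interpret r: wo_rel r by (simp add: wo_rel_def)
  define C where "C a = g -` underS r a \<inter> A" for a
  have top: "topspace (pullback_topology A g (initial_segment_topology r)) = A"
    using g by (auto simp: topspace_pullback_topology topspace_initial_segment_topology[OF wo])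
  have "open_chain r (pullback_topology A g (initial_segment_topology r)) C"
    unfolding open_chain_def top
  proof (intro conjI ballI allI impI)
    fix a assume a: "a \<in> Field r"
    show "openin (pullback_topology A g (initial_segment_topology r)) (C a)"
      using a unfolding openin_pullback_topology openin_initial_segment_topology[OF wo] C_def by blast
    \<comment> \<open>A point lying over \<open>a\<close> itself is missed, because
      \<open>underS\<close> is strict.\<close>
    have "a \<in> g ` A"
      using a g by simp
    then obtain x where "x \<in> A" "g x = a"
      by (rule imageE) simp
    then show "C a \<noteq> A"
      by (auto simp: C_def underS_def)
  next
    fix a b assume "(a, b) \<in> r"
    then show "C a \<subseteq> C b"
      unfolding C_def using underS_incr[OF r.TRANS r.ANTISYM] by blast
  next
    have "\<exists>a\<in>Field r. x \<in> C a" if "x \<in> A" for x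
    proof -
      have "g x \<in> Field r"
        using that g by blast
      from Cinfinite_limit[OF this r(1)] that show ?thesis
        unfolding C_def underS_def by auto
    qed
    then show "(\<Union>a\<in>Field r. C a) = A"
      unfolding C_def by blast
  qed
  then show ?thesis
    by (rule open_chain_imp_not_bracket_compact[OF r])
qed

section \<open>From non-compactness of the product back to the sets \<open>B\<close>\<close>

text \<open>With \<open>g\<close> the identity this gives (a) from (c); with \<open>g\<close> a
  surjection from the point type of (b) it gives (a) from (b). Openness in a factor depends only on
  the value under \<open>g\<close>, so the comparison with \<alpha> is made after applying
  \<open>g \<beta>\<close>.\<close>

lemma box_pullback_not_bracket_compact_imp_covering_matrix:
  assumes lam: "Cinfinite lam" and \<nu>: "Cinfinite \<nu>"
    and \<mu>: "\<And>\<beta>. \<beta> \<in> I \<Longrightarrow> Well_order (\<mu> \<beta>)"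
    and g: "\<And>\<beta>. \<beta> \<in> I \<Longrightarrow> g \<beta> ` A \<beta> = Field (\<mu> \<beta>)"
    and X: "\<not> bracket_compact lam lam
      (box_topology \<nu> I (\<lambda>\<beta>. pullback_topology (A \<beta>) (g \<beta>) (initial_segment_topology (\<mu> \<beta>))))"
      (is "\<not> bracket_compact lam lam (box_topology \<nu> I ?X)")
  shows "\<exists>B. covering_matrix lam \<nu> I \<mu> B"
proof -
  obtain C where C: "open_chain lam (box_topology \<nu> I ?X) C"
    using not_bracket_compact_imp_open_chain[OF lam X] by blast
  interpret lam: wo_rel lam
    using lam by (simp add: card_order_on_well_order_on wo_rel_def)
  have tX: "topspace (?X \<beta>) = A \<beta>" if "\<beta> \<in> I" for \<beta>
    using g[OF that]
    by (auto simp: topspace_pullback_topology topspace_initial_segment_topology[OF \<mu>[OF that]])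
  have top: "topspace (box_topology \<nu> I ?X) = (\<Pi>\<^sub>E \<beta>\<in>I. A \<beta>)"
    unfolding topspace_box_topology[OF \<nu>] using tX by (rule PiE_cong)
  have "\<exists>x\<in>(\<Pi>\<^sub>E \<beta>\<in>I. A \<beta>). x \<notin> C \<xi>" if "\<xi> \<in> Field lam" for \<xi>
    using open_chainD(2)[OF C that] unfolding top .
  then obtain x where x: "\<And>\<xi>. \<xi> \<in> Field lam \<Longrightarrow> x \<xi> \<in> (\<Pi>\<^sub>E \<beta>\<in>I. A \<beta>) \<and> x \<xi> \<notin> C \<xi>"
    by metis
  have gx: "g \<beta> (x \<xi> \<beta>) \<in> Field (\<mu> \<beta>)" if "\<xi> \<in> Field lam" "\<beta> \<in> I" for \<xi> \<beta>
    using x[OF that(1)] g[OF that(2)] that(2) by (auto simp: PiE_iff)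
  define B where "B \<alpha> \<beta> = {\<xi> \<in> Field lam. (g \<beta> (x \<xi> \<beta>), \<alpha>) \<in> \<mu> \<beta>}" for \<alpha> \<beta>
  have "covering_matrix lam \<nu> I \<mu> B"
    unfolding covering_matrix_def
  proof (intro conjI ballI allI impI)
    fix \<alpha> \<beta> show "B \<alpha> \<beta> \<subseteq> Field lam"
      unfolding B_def by blast
  next
    fix \<beta> assume \<beta>: "\<beta> \<in> I"
    interpret \<mu>\<beta>: wo_rel "\<mu> \<beta>" using \<mu>[OF \<beta>] by (simp add: wo_rel_def)
    show "(\<Union>\<alpha>\<in>Field (\<mu> \<beta>). B \<alpha> \<beta>) = Field lam"
      using gx[OF _ \<beta>] \<mu>\<beta>.REFL unfolding B_def refl_on_def by blast
    show "B \<alpha> \<beta> \<subseteq> B \<alpha>' \<beta>" if "(\<alpha>, \<alpha>') \<in> \<mu> \<beta>" for \<alpha> \<alpha>'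
      using that \<mu>\<beta>.TRANS unfolding B_def trans_def by blast
  next
    fix f assume f: "f \<in> (\<Pi>\<^sub>E \<beta>\<in>I. Field (\<mu> \<beta>))"
    then have "\<exists>a\<in>A \<beta>. g \<beta> a = f \<beta>" if "\<beta> \<in> I" for \<beta>
      using g[OF that] that by (metis PiE_mem imageE)
    \<comment> \<open>The function \<open>f\<close> is lifted to a point of the product. A basic box
      around it inside some \<open>C \<delta>\<close> supplies \<open>F\<close>: the coordinates
      that the box really restricts.\<close>
    then obtain p where p: "\<And>\<beta>. \<beta> \<in> I \<Longrightarrow> p \<beta> \<in> A \<beta> \<and> g \<beta> (p \<beta>) = f \<beta>"
      by metis
    then have "restrict p I \<in> (\<Pi>\<^sub>E \<beta>\<in>I. A \<beta>)"
      by auto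
    then obtain \<delta> where \<delta>: "\<delta> \<in> Field lam" "restrict p I \<in> C \<delta>"
      using open_chainD(4)[OF C] unfolding top by blast
    then obtain V where V: "box_base \<nu> I ?X V" "restrict p I \<in> V" "V \<subseteq> C \<delta>"
      using openin_box_topology_box[OF \<nu> open_chainD(1)[OF C]] by metis
    then obtain Y where Y: "V = (\<Pi>\<^sub>E \<beta>\<in>I. Y \<beta>)" "\<forall>\<beta>\<in>I. openin (?X \<beta>) (Y \<beta>)"
        "|{\<beta>\<in>I. Y \<beta> \<noteq> topspace (?X \<beta>)}| <o \<nu>"
      unfolding box_base_def by blast
    define F where "F = {\<beta>\<in>I. Y \<beta> \<noteq> topspace (?X \<beta>)}"
    have "Field lam \<inter> (\<Inter>\<beta>\<in>F. B (f \<beta>) \<beta>) \<subseteq> underS lam \<delta>"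
    proof
      fix \<xi> assume \<xi>: "\<xi> \<in> Field lam \<inter> (\<Inter>\<beta>\<in>F. B (f \<beta>) \<beta>)"
      \<comment> \<open>On \<open>F\<close>, membership of \<xi> in
        \<open>B (f \<beta>) \<beta>\<close> puts the image of \<open>x \<xi> \<beta>\<close> below
        \<open>f \<beta>\<close>, and open sets are closed downwards; off \<open>F\<close> the side
        is the whole factor.\<close>
      have "x \<xi> \<beta> \<in> Y \<beta>" if \<beta>: "\<beta> \<in> I" for \<beta>
      proof (cases "\<beta> \<in> F")
        case True
        obtain U where U: "openin (initial_segment_topology (\<mu> \<beta>)) U" "Y \<beta> = g \<beta> -` U \<inter> A \<beta>"
          using Y(2) \<beta> unfolding openin_pullback_topology by blast
        have "p \<beta> \<in> Y \<beta>"
          using V(2) Y(1) \<beta> by (auto simp: PiE_iff)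
        then have "f \<beta> \<in> U"
          using U(2) p[OF \<beta>] by auto
        moreover have "(g \<beta> (x \<xi> \<beta>), f \<beta>) \<in> \<mu> \<beta>"
          using \<xi> True unfolding B_def by blast
        ultimately have "g \<beta> (x \<xi> \<beta>) \<in> U"
          using openin_initial_segment_topology_downward[OF \<mu>[OF \<beta>] U(1)] by blast
        then show ?thesis
          using U(2) x \<xi> \<beta> by (auto simp: PiE_iff)
      next
        case False
        then show ?thesis
          using \<beta> tX[OF \<beta>] x \<xi> unfolding F_def by (auto simp: PiE_iff)
      qed
      then have "x \<xi> \<in> V"
        using Y(1) x \<xi> by (auto simp: PiE_iff)
      then have "x \<xi> \<in> C \<delta>"
        using V(3) by blast
      \<comment> \<open>Otherwise \<open>C \<delta> \<subseteq> C \<xi>\<close> would contain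
        \<open>x \<xi>\<close>, which was chosen outside \<open>C \<xi>\<close>.\<close>
      then have "(\<delta>, \<xi>) \<notin> lam"
        using open_chainD(3)[OF C] x \<xi> by blast
      then show "\<xi> \<in> underS lam \<delta>"
        using \<xi> \<delta>(1) lam.TOTALS lam.REFL unfolding underS_def refl_on_def by blast
    qed
    moreover have "|underS lam \<delta>| <o lam"
      using card_of_underS[OF _ \<delta>(1)] lam by simp
    ultimately have "|Field lam \<inter> (\<Inter>\<beta>\<in>F. B (f \<beta>) \<beta>)| <o lam"
      by (rule ordLeq_ordLess_trans[OF card_of_mono1])
    then show "\<exists>F\<subseteq>I. |F| <o \<nu> \<and> |Field lam \<inter> (\<Inter>\<beta>\<in>F. B (f \<beta>) \<beta>)| <o lam"
      using Y(3) by (intro exI[of _ F]) (auto simp: F_def)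
  qed
  then show ?thesis by blast
qed

section \<open>The equivalence of the three conditions\<close>

text \<open>Presents the factors in (c) as pullbacks, so that the results on pullbacks apply to
  them.\<close>

lemma pullback_topology_id:
  "pullback_topology (topspace X) id X = X"
  unfolding topology_eq openin_pullback_topology
proof
  fix S
  show "(\<exists>U. openin X U \<and> S = id -` U \<inter> topspace X) \<longleftrightarrow> openin X S"
  proof
    assume S: "openin X S"
    then show "\<exists>U. openin X U \<and> S = id -` U \<inter> topspace X"
      using openin_subset[OF S] by (intro exI[of _ S]) auto
  qed auto
qed

text \<open>Condition (b) ranges over spaces with points in one type \<open>'x\<close>, hence the
  size assumption for deriving (a) from it: \<open>'x\<close> must have room for every
  \<open>\<mu> \<beta>\<close>. For \<open>'x\<close> equal to \<open>'m\<close> that assumption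
  holds automatically, and all three conditions are equivalent.\<close>

theorem theorem6:
  fixes lam :: "'l rel" and \<kappa> :: "'k rel" and \<nu> :: "'n rel" and \<mu> :: "'k \<Rightarrow> 'm rel"
  assumes "Cinfinite lam" "regularCard lam"
    and "Cinfinite \<kappa>"
    and "Cinfinite \<nu>"
    and "\<And>\<beta>. \<beta> \<in> Field \<kappa> \<Longrightarrow> Cinfinite (\<mu> \<beta>) \<and> regularCard (\<mu> \<beta>)"
  shows
    "let
       a = (\<exists>B :: 'm \<Rightarrow> 'k \<Rightarrow> 'l set.
              (\<forall>\<beta>\<in>Field \<kappa>. \<forall>\<alpha>\<in>Field (\<mu> \<beta>). B \<alpha> \<beta> \<subseteq> Field lam) \<and>
              (\<forall>\<beta>\<in>Field \<kappa>. (\<Union>\<alpha>\<in>Field (\<mu> \<beta>). B \<alpha> \<beta>) = Field lam) \<and>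
              (\<forall>\<beta>\<in>Field \<kappa>. \<forall>\<alpha> \<alpha>'. (\<alpha>, \<alpha>') \<in> \<mu> \<beta> \<longrightarrow> B \<alpha> \<beta> \<subseteq> B \<alpha>' \<beta>) \<and>
              (\<forall>f \<in> (\<Pi>\<^sub>E \<beta>\<in>Field \<kappa>. Field (\<mu> \<beta>)).
                 \<exists>F\<subseteq>Field \<kappa>. |F| <o \<nu> \<and> |Field lam \<inter> (\<Inter>\<beta>\<in>F. B (f \<beta>) \<beta>)| <o lam));
       b = (\<forall>X :: 'k \<Rightarrow> 'x topology.
              (\<forall>\<beta>\<in>Field \<kappa>. \<not> bracket_compact (\<mu> \<beta>) (\<mu> \<beta>) (X \<beta>)) \<longrightarrow>
              \<not> bracket_compact lam lam (box_topology \<nu> (Field \<kappa>) X));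
       c = (\<not> bracket_compact lam lam
              (box_topology \<nu> (Field \<kappa>) (\<lambda>\<beta>. initial_segment_topology (\<mu> \<beta>))))
     in
       (a \<longleftrightarrow> c) \<and> (a \<longrightarrow> b) \<and>
       ((\<forall>\<beta>\<in>Field \<kappa>. |Field (\<mu> \<beta>)| \<le>o |UNIV :: 'x set| ) \<longrightarrow> b \<longrightarrow> a)"
proof -
  let ?I = "Field \<kappa>"
  let ?init = "\<lambda>\<beta>. initial_segment_topology (\<mu> \<beta>)"
  have \<mu>: "Cinfinite (\<mu> \<beta>)" "regularCard (\<mu> \<beta>)" "Well_order (\<mu> \<beta>)" if "\<beta> \<in> ?I" for \<beta>
    using assms(5)[OF that] by (auto simp: card_order_on_well_order_on)
  define c where "c \<longleftrightarrow> \<not> bracket_compact lam lam (box_topology \<nu> ?I ?init)"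
  define b where "b \<longleftrightarrow> (\<forall>X :: 'k \<Rightarrow> 'x topology.
      (\<forall>\<beta>\<in>?I. \<not> bracket_compact (\<mu> \<beta>) (\<mu> \<beta>) (X \<beta>)) \<longrightarrow>
      \<not> bracket_compact lam lam (box_topology \<nu> ?I X))"
  define a where "a \<longleftrightarrow> (\<exists>B :: 'm \<Rightarrow> 'k \<Rightarrow> 'l set. covering_matrix lam \<nu> ?I \<mu> B)"
  have init: "pullback_topology (Field (\<mu> \<beta>)) id (?init \<beta>) = ?init \<beta>" if "\<beta> \<in> ?I" for \<beta>
    using pullback_topology_id[of "?init \<beta>"] topspace_initial_segment_topology[OF \<mu>(3)[OF that]]
    by simp
  \<comment> \<open>Outside \<open>?I\<close> the relation \<open>\<mu> \<beta>\<close> is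
    arbitrary, so the two families are not compared as functions but through
    \<open>box_base\<close>, which looks only at indices in \<open>?I\<close>.\<close>
  have box_init: "box_topology \<nu> ?I (\<lambda>\<beta>. pullback_topology (Field (\<mu> \<beta>)) id (?init \<beta>)) =
      box_topology \<nu> ?I ?init"
  proof -
    have "box_base \<nu> ?I (\<lambda>\<beta>. pullback_topology (Field (\<mu> \<beta>)) id (?init \<beta>)) = box_base \<nu> ?I ?init"
      unfolding box_base_def using init by (simp cong: conj_cong ball_cong)
    then show ?thesis unfolding box_topology_def by simp
  qed
  have ab: "b" if "a"
  proof -
    obtain B where "covering_matrix lam \<nu> ?I \<mu> B"
      using \<open>a\<close> unfolding a_def ..
    note * = covering_matrix_imp_box_not_bracket_compact[OF assms(1,2,4) \<mu>(1) this]
    show ?thesis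
      unfolding b_def by (intro allI impI) (rule *, auto)
  qed
  have init_nc: "\<not> bracket_compact (\<mu> \<beta>) (\<mu> \<beta>) (?init \<beta>)" if "\<beta> \<in> ?I" for \<beta>
    using pullback_initial_segment_not_bracket_compact[OF \<mu>(1)[OF that] \<mu>(2)[OF that], of id "Field (\<mu> \<beta>)"]
      init[OF that] by simp
  have ac: "c" if "a"
  proof -
    obtain B where "covering_matrix lam \<nu> ?I \<mu> B"
      using \<open>a\<close> unfolding a_def ..
    from covering_matrix_imp_box_not_bracket_compact[OF assms(1,2,4) \<mu>(1) this init_nc]
    show ?thesis
      unfolding c_def by simp
  qed
  have ca: "a" if "c"
    unfolding a_def
    by (rule box_pullback_not_bracket_compact_imp_covering_matrix[OF assms(1,4) \<mu>(3),
          where g = "\<lambda>_. id" and A = "\<lambda>\<beta>. Field (\<mu> \<beta>)"])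
      (use that in \<open>simp_all add: c_def box_init\<close>)
  have ba: "a" if "b" and le: "\<forall>\<beta>\<in>?I. |Field (\<mu> \<beta>)| \<le>o |UNIV :: 'x set|"
  proof -
    \<comment> \<open>The size assumption gives surjections from all of \<open>'x\<close>; pulling
      back along them yields a family to which (b) applies.\<close>
    have "\<exists>g :: 'x \<Rightarrow> 'm. range g = Field (\<mu> \<beta>)" if "\<beta> \<in> ?I" for \<beta>
    proof -
      have "Field (\<mu> \<beta>) \<noteq> {}"
        using \<mu>(1)[OF that] unfolding cinfinite_def by fastforce
      then show ?thesis
        using le that card_of_ordLeq2 by metis
    qed
    then obtain g :: "'k \<Rightarrow> 'x \<Rightarrow> 'm" where g: "\<And>\<beta>. \<beta> \<in> ?I \<Longrightarrow> range (g \<beta>) = Field (\<mu> \<beta>)"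
      by metis
    have "\<not> bracket_compact lam lam
        (box_topology \<nu> ?I (\<lambda>\<beta>. pullback_topology UNIV (g \<beta>) (?init \<beta>)))"
      using \<open>b\<close> pullback_initial_segment_not_bracket_compact[OF \<mu>(1,2) g]
      unfolding b_def by simp
    from box_pullback_not_bracket_compact_imp_covering_matrix[OF assms(1,4) \<mu>(3) g this]
    show ?thesis
      unfolding a_def by simp
  qed
  have "(a \<longleftrightarrow> c) \<and> (a \<longrightarrow> b) \<and>
      ((\<forall>\<beta>\<in>?I. |Field (\<mu> \<beta>)| \<le>o |UNIV :: 'x set| ) \<longrightarrow> b \<longrightarrow> a)"
    using ab ac ca ba by blast
  then show ?thesis
    unfolding a_def b_def c_def covering_matrix_def Let_def .
qed

end
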